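(* Let $F$ and $G$ be finite groups and suppose that $\Bbbk^G{}^\tau\#_{\sigma}\Bbbk F$ is a quasitriangular Hopf algebra. Then $O'_gO'_{g'}=O'_{g'}O'_g$ for all $g,g'\in G$.
   Context: $\Bbbk$ is an algebraically closed field of characteristic zero. $(F,G,\triangleleft,\triangleright)$ is a matched pair of groups: $\triangleleft:G\times F\to G$ is a right action of $F$ on the set $G$ and $\triangleright:G\times F\to F$ is a left action of $G$ on the set $F$, such that $g\triangleright(ff')=(g\triangleright f)((g\triangleleft f)\triangleright f')$ and $(gg')\triangleleft f=(g\triangleleft(g'\triangleright f))(g'\triangleleft f)$ for all $g,g'\in G$, $f,f'\in F$. The maps $\sigma:G\times F\times F\to\Bbbk^\times$ and $\tau:G\times G\times F\to\Bbbk^\times$ satisfy, for all $g,g',g''\in G$, $f,f',f''\in F$: $\sigma(g;1_F,f)=\sigma(g;f,1_F)=\sigma(1_G;f,f')=1$; $\sigma(g\triangleleft f;f',f'')\sigma(g;f,f'f'')=\sigma(g;f,f')\sigma(g;ff',f'')$; $\tau(1_G,g;f)=\tau(g,1_G;f)=\tau(g,g';1_F)=1$; $\tau(g,g';g''\triangleright f)\tau(gg',g'';f)=\tau(g,g'g'';f)\tau(g',g'';f)$; $\sigma(gg';f,f')\tau(g,g';ff')=\sigma(g;g'\triangleright f,(g'\triangleleft f)\triangleright f')\,\sigma(g';f,f')\,\tau(g,g';f)\,\tau(g\triangleleft(g'\triangleright f),g'\triangleleft f;f')$. The Hopf algebra $\Bbbk^G{}^\tau\#_{\sigma}\Bbbk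 F$ is the vector space $\Bbbk^G\otimes\Bbbk F$ with basis $p_g\# f:=p_g\otimes f$ ($g\in G,f\in F$; $\{p_g\}$ is the basis of $\Bbbk^G$ dual to $G\subset\Bbbk G$), multiplication $(p_g\# f)(p_{g'}\# f')=\delta_{g\triangleleft f,g'}\sigma(g;f,f')\,p_g\# ff'$, comultiplication $\Delta(p_g\# f)=\sum_{x\in G}\tau(gx^{-1},x;f)\,(p_{gx^{-1}}\#(x\triangleright f))\otimes(p_x\# f)$, unit $\sum_{g\in G}p_g\#1_F$, counit $\varepsilon(p_g\# f)=\delta_{g,1_G}$, and antipode $S(p_g\# f)=\sigma(g^{-1};g\triangleright f,(g\triangleright f)^{-1})^{-1}\tau(g^{-1},g;f)^{-1}p_{(g\triangleleft f)^{-1}}\#(g\triangleright f)^{-1}$. A Hopf algebra $H$ is quasitriangular if there is an invertible element $R=\sum R^{(1)}\otimes R^{(2)}\in H\otimes H$ with $(\Delta\otimes\operatorname{id})(R)=R_{13}R_{23}$, $(\operatorname{id}\otimes\Delta)(R)=R_{13}R_{12}$ and $\Delta^{op}(h)R=R\Delta(h)$ for all $h\in H$, where $R_{12}=\sum R^{(1)}\otimes R^{(2)}\otimes1$, $R_{13}=\sum R^{(1)}\otimes1\otimes R^{(2)}$, $R_{23}=\sum1\otimes R^{(1)}\otimes R^{(2)}$. For $g,g'\in G$: $O'_g=\{g\triangleleft f\mid f\in F\}$ and $O'_gO'_{g'}=\{xy\mid x\in O'_g,\,y\in O'_{g'}\}$. *)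

theory Defs
  imports "HOL-Algebra.Coset" "HOL-Computational_Algebra.Polynomial"
begin

text \<open>
  The finite-dimensional vector space over \<open>'k\<close> with basis \<open>B\<close> is the set of coordinate functions vanishing outside
  \<open>B\<close>; the tensor product of the spaces with bases \<open>A\<close> and \<open>B\<close> is the space with basis
  \<open>A \<times> B\<close>, the pair \<open>(a, b)\<close> standing for \<open>a \<otimes> b\<close>.
  A linear map is given by the images of the basis vectors, i.e. by a function
  \<open>'a \<Rightarrow> ('b \<Rightarrow> 'k)\<close>; \<open>lin B \<phi>\<close> is its linear extension, and \<open>bvec\<close> itself is the identity map.
\<close>

definition vecs :: "'a set \<Rightarrow> ('a \<Rightarrow> 'k::field) set" where
  "vecs B = {x. \<forall>b. b \<notin> B \<longrightarrow> x b = 0}"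

definition bvec :: "'a \<Rightarrow> 'a \<Rightarrow> 'k::field" where
  "bvec b = (\<lambda>c. if c = b then 1 else 0)"

definition lin :: "'a set \<Rightarrow> ('a \<Rightarrow> 'b \<Rightarrow> 'k::field) \<Rightarrow> ('a \<Rightarrow> 'k) \<Rightarrow> 'b \<Rightarrow> 'k" where
  "lin B \<phi> x = (\<lambda>c. \<Sum>b\<in>B. x b * \<phi> b c)"

definition tens :: "('a \<Rightarrow> 'k::field) \<Rightarrow> ('b \<Rightarrow> 'k) \<Rightarrow> 'a \<times> 'b \<Rightarrow> 'k" where
  "tens x y = (\<lambda>(a, b). x a * y b)"

definition tensor_map ::
    "('a \<Rightarrow> 'c \<Rightarrow> 'k::field) \<Rightarrow> ('b \<Rightarrow> 'd \<Rightarrow> 'k) \<Rightarrow> 'a \<times> 'b \<Rightarrow> 'c \<times> 'd \<Rightarrow> 'k" where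
  "tensor_map \<phi> \<psi> = (\<lambda>(a, b). tens (\<phi> a) (\<psi> b))"

definition tensor_flip :: "('a \<times> 'b \<Rightarrow> 'k::field) \<Rightarrow> 'b \<times> 'a \<Rightarrow> 'k" where
  "tensor_flip w = (\<lambda>(b, a). w (a, b))"

definition tensor_reassoc :: "(('a \<times> 'b) \<times> 'c \<Rightarrow> 'k::field) \<Rightarrow> 'a \<times> 'b \<times> 'c \<Rightarrow> 'k" where
  "tensor_reassoc w = (\<lambda>(a, b, c). w ((a, b), c))"

text \<open>
  The structure maps are given on basis vectors: \<open>mulc A a b c\<close> is the coefficient of \<open>c\<close> in the
  product of \<open>a\<close> and \<open>b\<close>, \<open>comulc H a (b, c)\<close> the coefficient of \<open>b \<otimes> c\<close> in the coproduct of \<open>a\<close>,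
  and \<open>antipc H a b\<close> the coefficient of \<open>b\<close> in the antipode of \<open>a\<close>.
\<close>

record ('a, 'k) based_alg =
  basis :: "'a set"
  mulc :: "'a \<Rightarrow> 'a \<Rightarrow> 'a \<Rightarrow> 'k"
  unt :: "'a \<Rightarrow> 'k"

record ('a, 'k) based_hopf = "('a, 'k) based_alg" +
  comulc :: "'a \<Rightarrow> 'a \<times> 'a \<Rightarrow> 'k"
  counitc :: "'a \<Rightarrow> 'k"
  antipc :: "'a \<Rightarrow> 'a \<Rightarrow> 'k"

definition amul :: "('a, 'k::field, 'm) based_alg_scheme \<Rightarrow> ('a \<Rightarrow> 'k) \<Rightarrow> ('a \<Rightarrow> 'k) \<Rightarrow> 'a \<Rightarrow> 'k" where
  "amul A x y = lin (basis A \<times> basis A) (\<lambda>(a, b). mulc A a b) (tens x y)"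

definition tensor_alg ::
    "('a, 'k::field, 'm) based_alg_scheme \<Rightarrow> ('b, 'k, 'n) based_alg_scheme \<Rightarrow> ('a \<times> 'b, 'k) based_alg" where
  "tensor_alg A B =
    \<lparr> basis = basis A \<times> basis B,
      mulc = (\<lambda>(a, b) (a', b'). tens (mulc A a a') (mulc B b b')),
      unt = tens (unt A) (unt B) \<rparr>"

definition comul :: "('a, 'k::field, 'm) based_hopf_scheme \<Rightarrow> ('a \<Rightarrow> 'k) \<Rightarrow> 'a \<times> 'a \<Rightarrow> 'k" where
  "comul H x = lin (basis H) (comulc H) x"

definition counit :: "('a, 'k::field, 'm) based_hopf_scheme \<Rightarrow> ('a \<Rightarrow> 'k) \<Rightarrow> 'k" where
  "counit H x = (\<Sum>b\<in>basis H. x b * counitc H b)"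

definition based_algebra :: "('a, 'k::field, 'm) based_alg_scheme \<Rightarrow> bool" where
  "based_algebra A \<longleftrightarrow>
     finite (basis A) \<and>
     unt A \<in> vecs (basis A) \<and>
     (\<forall>a\<in>basis A. \<forall>b\<in>basis A. mulc A a b \<in> vecs (basis A)) \<and>
     (\<forall>x\<in>vecs (basis A). \<forall>y\<in>vecs (basis A). \<forall>z\<in>vecs (basis A).
        amul A (amul A x y) z = amul A x (amul A y z)) \<and>
     (\<forall>x\<in>vecs (basis A). amul A (unt A) x = x \<and> amul A x (unt A) = x)"

definition based_coalgebra :: "('a, 'k::field, 'm) based_hopf_scheme \<Rightarrow> bool" where
  "based_coalgebra H \<longleftrightarrow>
     finite (basis H) \<and>
     (\<forall>a\<in>basis H. comulc H a \<in> vecs (basis H \<times> basis H)) \<and>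
     (\<forall>x\<in>vecs (basis H).
        tensor_reassoc (lin (basis H \<times> basis H) (tensor_map (comulc H) bvec) (comul H x))
          = lin (basis H \<times> basis H) (tensor_map bvec (comulc H)) (comul H x)) \<and>
     (\<forall>x\<in>vecs (basis H).
        lin (basis H \<times> basis H) (\<lambda>(a, b) c. counitc H a * bvec b c) (comul H x) = x \<and>
        lin (basis H \<times> basis H) (\<lambda>(a, b) c. counitc H b * bvec a c) (comul H x) = x)"

definition hopf_algebra :: "('a, 'k::field, 'm) based_hopf_scheme \<Rightarrow> bool" where
  "hopf_algebra H \<longleftrightarrow>
     based_algebra H \<and> based_coalgebra H \<and>
     (\<forall>x\<in>vecs (basis H). \<forall>y\<in>vecs (basis H).
        comul H (amul H x y) = amul (tensor_alg H H) (comul H x) (comul H y) \<and>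
        counit H (amul H x y) = counit H x * counit H y) \<and>
     comul H (unt H) = unt (tensor_alg H H) \<and>
     counit H (unt H) = 1 \<and>
     (\<forall>a\<in>basis H. antipc H a \<in> vecs (basis H)) \<and>
     (\<forall>x\<in>vecs (basis H).
        lin (basis H \<times> basis H) (\<lambda>(a, b). mulc H a b)
          (lin (basis H \<times> basis H) (tensor_map (antipc H) bvec) (comul H x))
          = (\<lambda>c. counit H x * unt H c) \<and>
        lin (basis H \<times> basis H) (\<lambda>(a, b). mulc H a b)
          (lin (basis H \<times> basis H) (tensor_map bvec (antipc H)) (comul H x))
          = (\<lambda>c. counit H x * unt H c))"

definition leg12 :: "('a, 'k::field, 'm) based_alg_scheme \<Rightarrow> ('a \<times> 'a \<Rightarrow> 'k) \<Rightarrow> 'a \<times> 'a \<times> 'a \<Rightarrow> 'k" where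
  "leg12 A R = (\<lambda>(a, b, c). R (a, b) * unt A c)"

definition leg13 :: "('a, 'k::field, 'm) based_alg_scheme \<Rightarrow> ('a \<times> 'a \<Rightarrow> 'k) \<Rightarrow> 'a \<times> 'a \<times> 'a \<Rightarrow> 'k" where
  "leg13 A R = (\<lambda>(a, b, c). R (a, c) * unt A b)"

definition leg23 :: "('a, 'k::field, 'm) based_alg_scheme \<Rightarrow> ('a \<times> 'a \<Rightarrow> 'k) \<Rightarrow> 'a \<times> 'a \<times> 'a \<Rightarrow> 'k" where
  "leg23 A R = (\<lambda>(a, b, c). unt A a * R (b, c))"

definition quasitriangular_hopf_algebra :: "('a, 'k::field, 'm) based_hopf_scheme \<Rightarrow> bool" where
  "quasitriangular_hopf_algebra H \<longleftrightarrow>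
     hopf_algebra H \<and>
     (let B2 = basis H \<times> basis H; H2 = tensor_alg H H; H3 = tensor_alg H H2 in
      \<exists>R\<in>vecs B2.
        (\<exists>R'\<in>vecs B2. amul H2 R R' = unt H2 \<and> amul H2 R' R = unt H2) \<and>
        tensor_reassoc (lin B2 (tensor_map (comulc H) bvec) R) = amul H3 (leg13 H R) (leg23 H R) \<and>
        lin B2 (tensor_map bvec (comulc H)) R = amul H3 (leg13 H R) (leg12 H R) \<and>
        (\<forall>h\<in>vecs (basis H). amul H2 (tensor_flip (comul H h)) R = amul H2 R (comul H h)))"

text \<open>\<open>ract g f\<close> is $g \triangleleft f$ and \<open>lact g f\<close> is $g \triangleright f$.\<close>

locale matched_pair = F: group F + G: group G
  for F :: "('f, 'm) monoid_scheme" and G :: "('g, 'n) monoid_scheme" +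
  fixes ract :: "'g \<Rightarrow> 'f \<Rightarrow> 'g" and lact :: "'g \<Rightarrow> 'f \<Rightarrow> 'f"
  assumes ract_closed: "\<lbrakk>g \<in> carrier G; f \<in> carrier F\<rbrakk> \<Longrightarrow> ract g f \<in> carrier G"
    and ract_one: "g \<in> carrier G \<Longrightarrow> ract g \<one>\<^bsub>F\<^esub> = g"
    and ract_mult: "\<lbrakk>g \<in> carrier G; f \<in> carrier F; f' \<in> carrier F\<rbrakk> \<Longrightarrow>
      ract g (f \<otimes>\<^bsub>F\<^esub> f') = ract (ract g f) f'"
    and lact_closed: "\<lbrakk>g \<in> carrier G; f \<in> carrier F\<rbrakk> \<Longrightarrow> lact g f \<in> carrier F"
    and one_lact: "f \<in> carrier F \<Longrightarrow> lact \<one>\<^bsub>G\<^esub> f = f"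
    and mult_lact: "\<lbrakk>g \<in> carrier G; g' \<in> carrier G; f \<in> carrier F\<rbrakk> \<Longrightarrow>
      lact (g \<otimes>\<^bsub>G\<^esub> g') f = lact g (lact g' f)"
    and lact_mult: "\<lbrakk>g \<in> carrier G; f \<in> carrier F; f' \<in> carrier F\<rbrakk> \<Longrightarrow>
      lact g (f \<otimes>\<^bsub>F\<^esub> f') = lact g f \<otimes>\<^bsub>F\<^esub> lact (ract g f) f'"
    and mult_ract: "\<lbrakk>g \<in> carrier G; g' \<in> carrier G; f \<in> carrier F\<rbrakk> \<Longrightarrow>
      ract (g \<otimes>\<^bsub>G\<^esub> g') f = ract g (lact g' f) \<otimes>\<^bsub>G\<^esub> ract g' f"

locale bicrossed_datum = matched_pair F G ract lact
  for F :: "('f, 'm) monoid_scheme" and G :: "('g, 'n) monoid_scheme" and ract lact +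
  fixes \<sigma> :: "'g \<Rightarrow> 'f \<Rightarrow> 'f \<Rightarrow> 'k::field" and \<tau> :: "'g \<Rightarrow> 'g \<Rightarrow> 'f \<Rightarrow> 'k"
  assumes sigma_nonzero: "\<lbrakk>g \<in> carrier G; f \<in> carrier F; f' \<in> carrier F\<rbrakk> \<Longrightarrow> \<sigma> g f f' \<noteq> 0"
    and tau_nonzero: "\<lbrakk>g \<in> carrier G; g' \<in> carrier G; f \<in> carrier F\<rbrakk> \<Longrightarrow> \<tau> g g' f \<noteq> 0"
    and sigma_norm1: "\<lbrakk>g \<in> carrier G; f \<in> carrier F\<rbrakk> \<Longrightarrow> \<sigma> g \<one>\<^bsub>F\<^esub> f = 1"
    and sigma_norm2: "\<lbrakk>g \<in> carrier G; f \<in> carrier F\<rbrakk> \<Longrightarrow> \<sigma> g f \<one>\<^bsub>F\<^esub> = 1"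
    and sigma_norm3: "\<lbrakk>f \<in> carrier F; f' \<in> carrier F\<rbrakk> \<Longrightarrow> \<sigma> \<one>\<^bsub>G\<^esub> f f' = 1"
    and sigma_cocycle:
      "\<lbrakk>g \<in> carrier G; f \<in> carrier F; f' \<in> carrier F; f'' \<in> carrier F\<rbrakk> \<Longrightarrow>
       \<sigma> (ract g f) f' f'' * \<sigma> g f (f' \<otimes>\<^bsub>F\<^esub> f'') = \<sigma> g f f' * \<sigma> g (f \<otimes>\<^bsub>F\<^esub> f') f''"
    and tau_norm1: "\<lbrakk>g \<in> carrier G; f \<in> carrier F\<rbrakk> \<Longrightarrow> \<tau> \<one>\<^bsub>G\<^esub> g f = 1"
    and tau_norm2: "\<lbrakk>g \<in> carrier G; f \<in> carrier F\<rbrakk> \<Longrightarrow> \<tau> g \<one>\<^bsub>G\<^esub> f = 1"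
    and tau_norm3: "\<lbrakk>g \<in> carrier G; g' \<in> carrier G\<rbrakk> \<Longrightarrow> \<tau> g g' \<one>\<^bsub>F\<^esub> = 1"
    and tau_cocycle:
      "\<lbrakk>g \<in> carrier G; g' \<in> carrier G; g'' \<in> carrier G; f \<in> carrier F\<rbrakk> \<Longrightarrow>
       \<tau> g g' (lact g'' f) * \<tau> (g \<otimes>\<^bsub>G\<^esub> g') g'' f = \<tau> g (g' \<otimes>\<^bsub>G\<^esub> g'') f * \<tau> g' g'' f"
    and sigma_tau:
      "\<lbrakk>g \<in> carrier G; g' \<in> carrier G; f \<in> carrier F; f' \<in> carrier F\<rbrakk> \<Longrightarrow>
       \<sigma> (g \<otimes>\<^bsub>G\<^esub> g') f f' * \<tau> g g' (f \<otimes>\<^bsub>F\<^esub> f') =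
       \<sigma> g (lact g' f) (lact (ract g' f) f') * \<sigma> g' f f' * \<tau> g g' f *
       \<tau> (ract g (lact g' f)) (ract g' f) f'"

text \<open>The pair \<open>(g, f)\<close> is the basis vector $p_g \mathbin{\#} f$.\<close>

definition bicrossed_product ::
    "('f, 'm) monoid_scheme \<Rightarrow> ('g, 'n) monoid_scheme \<Rightarrow> ('g \<Rightarrow> 'f \<Rightarrow> 'g) \<Rightarrow> ('g \<Rightarrow> 'f \<Rightarrow> 'f) \<Rightarrow>
     ('g \<Rightarrow> 'f \<Rightarrow> 'f \<Rightarrow> 'k::field) \<Rightarrow> ('g \<Rightarrow> 'g \<Rightarrow> 'f \<Rightarrow> 'k) \<Rightarrow> ('g \<times> 'f, 'k) based_hopf" where
  "bicrossed_product F G ract lact \<sigma> \<tau> =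
    \<lparr> basis = carrier G \<times> carrier F,
      mulc = (\<lambda>(g, f) (g', f') p.
        if ract g f = g' then \<sigma> g f f' * bvec (g, f \<otimes>\<^bsub>F\<^esub> f') p else 0),
      unt = (\<lambda>p. \<Sum>g\<in>carrier G. bvec (g, \<one>\<^bsub>F\<^esub>) p),
      comulc = (\<lambda>(g, f) p. \<Sum>x\<in>carrier G.
        \<tau> (g \<otimes>\<^bsub>G\<^esub> inv\<^bsub>G\<^esub> x) x f * bvec ((g \<otimes>\<^bsub>G\<^esub> inv\<^bsub>G\<^esub> x, lact x f), (x, f)) p),
      counitc = (\<lambda>(g, f). if g = \<one>\<^bsub>G\<^esub> then 1 else 0),
      antipc = (\<lambda>(g, f) p.
        inverse (\<sigma> (inv\<^bsub>G\<^esub> g) (lact g f) (inv\<^bsub>F\<^esub> (lact g f))) * inverse (\<tau> (inv\<^bsub>G\<^esub> g) g f) *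
        bvec (inv\<^bsub>G\<^esub> (ract g f), inv\<^bsub>F\<^esub> (lact g f)) p) \<rparr>"

definition orb :: "('f, 'm) monoid_scheme \<Rightarrow> ('g \<Rightarrow> 'f \<Rightarrow> 'g) \<Rightarrow> 'g \<Rightarrow> 'g set" where
  "orb F ract g = {ract g f | f. f \<in> carrier F}"

end

theory Submission
  imports Defs
begin

text \<open>
  An \<open>R\<close>-matrix intertwines \<open>\<Delta>\<close> and \<open>\<Delta>\<^sup>o\<^sup>p\<close>, so tensor products of \<open>H\<close>-modules commute up to
  isomorphism. Restricting modules to the commutative subalgebra \<open>k\<^sup>G\<close> (\<open>k\<close> being the field) grades them by \<open>G\<close>, the degrees of a
  tensor product being products of degrees, and \<open>F\<close> permutes the degrees within orbits; comparing the degrees of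
  \<open>V \<otimes> W\<close> and \<open>W \<otimes> V\<close>, for modules whose degrees form a single orbit, gives the claim.

  In coordinates this becomes a statement about the entries of \<open>R\<close>. Multiplying by \<open>p\<^sub>x # 1\<close> from the left
  projects onto the span of the \<open>p\<^sub>x # f\<close>, and from the right onto the span of the \<open>p\<^sub>g # f\<close> with
  \<open>g \<triangleleft> f = x\<close>. Since \<open>\<Delta>(p\<^sub>z # 1)\<close> is the sum of all \<open>(p\<^sub>u # 1) \<otimes> (p\<^sub>v # 1)\<close> with \<open>u v = z\<close>, the equation
  \<open>\<Delta>\<^sup>o\<^sup>p(p\<^sub>z # 1) R = R \<Delta>(p\<^sub>z # 1)\<close> for \<open>z = b a\<close> shows that \<open>(p\<^sub>a # f) \<otimes> (p\<^sub>b # f')\<close> can occur in \<open>R\<close>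
  only if \<open>b a = (a \<triangleleft> f) (b \<triangleleft> f')\<close> (lemma \<open>intertwiner_support\<close>). As \<open>R\<close> is invertible, every pair
  \<open>a, b\<close> does occur, for some \<open>f, f'\<close> (lemma \<open>right_invertible_meets_all\<close>). Hence every product \<open>b a\<close> with
  \<open>b \<in> O'\<^sub>h\<close> and \<open>a \<in> O'\<^sub>g\<close> lies in \<open>O'\<^sub>g O'\<^sub>h\<close>, and exchanging \<open>g\<close> and \<open>h\<close> gives the other
  inclusion.
\<close>

context matched_pair
begin

lemma lact_one:
  assumes "g \<in> carrier G"
  shows "lact g \<one>\<^bsub>F\<^esub> = \<one>\<^bsub>F\<^esub>"
proof -
  have "lact g \<one>\<^bsub>F\<^esub> \<otimes>\<^bsub>F\<^esub> lact g \<one>\<^bsub>F\<^esub> = lact g \<one>\<^bsub>F\<^esub>"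
    using lact_mult[of g "\<one>\<^bsub>F\<^esub>" "\<one>\<^bsub>F\<^esub>"] assms by (simp add: ract_one)
  then show ?thesis
    using lact_closed[OF assms F.one_closed] F.r_cancel_one by metis
qed

lemma orb_subset: "g \<in> carrier G \<Longrightarrow> orb F ract g \<subseteq> carrier G"
  by (auto simp: orb_def ract_closed)

lemma ract_in_orb:
  assumes "g \<in> carrier G" "x \<in> orb F ract g" "f \<in> carrier F"
  shows "ract x f \<in> orb F ract g"
  using assms by (auto simp: orb_def ract_mult[symmetric])

end

context bicrossed_datum
begin

abbreviation H :: "('g \<times> 'f, 'k) based_hopf" where
  "H \<equiv> bicrossed_product F G ract lact \<sigma> \<tau>"

abbreviation H2 :: "(('g \<times> 'f) \<times> 'g \<times> 'f, 'k) based_alg" where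
  "H2 \<equiv> tensor_alg H H"

lemma basis_H [simp]: "basis H = carrier G \<times> carrier F"
  by (simp add: bicrossed_product_def)

lemma mulc_H:
  "mulc H (g, f) (g', f') p =
    (if ract g f = g' \<and> p = (g, f \<otimes>\<^bsub>F\<^esub> f') then \<sigma> g f f' else 0)"
  by (simp add: bicrossed_product_def bvec_def)

lemma mulc_H2:
  "mulc H2 ((g, f), (h, k)) ((g', f'), (h', k')) (p, q) =
    mulc H (g, f) (g', f') p * mulc H (h, k) (h', k') q"
  by (simp add: tensor_alg_def tens_def)

lemma amul_H2:
  "amul H2 X Y c = (\<Sum>(u, v) \<in> (basis H \<times> basis H) \<times> (basis H \<times> basis H). X u * Y v * mulc H2 u v c)"
  by (auto simp: amul_def lin_def tens_def tensor_alg_def intro!: sum.cong)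

text \<open>
  The first factor of a product of basis vectors keeps its \<open>G\<close>-component, and the second factor has to start
  where the first one ends.
\<close>

lemma amul_H2_nonzeroE:
  assumes "amul H2 X Y ((a, f), (b, f')) \<noteq> 0"
  obtains k k' l l' where
    "k \<in> carrier F" "k' \<in> carrier F" "l \<in> carrier F" "l' \<in> carrier F"
    "X ((a, k), (b, k')) \<noteq> 0" "Y ((ract a k, l), (ract b k', l')) \<noteq> 0"
    "f = k \<otimes>\<^bsub>F\<^esub> l" "f' = k' \<otimes>\<^bsub>F\<^esub> l'"
proof -
  obtain w where "w \<in> (basis H \<times> basis H) \<times> (basis H \<times> basis H)"
    and "(case w of (u, v) \<Rightarrow> X u * Y v * mulc H2 u v ((a, f), (b, f'))) \<noteq> 0"
    using assms unfolding amul_H2 by (rule sum.not_neutral_contains_not_neutral)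
  moreover obtain g k h k' g' l h' l' where "w = (((g, k), (h, k')), ((g', l), (h', l')))"
    by (metis surj_pair)
  ultimately show thesis
    by (intro that[of k k' l l']) (auto simp: mulc_H2 mulc_H split: if_splits)
qed

lemma unt_H:
  assumes "finite (carrier G)" "a \<in> carrier G"
  shows "unt H (a, \<one>\<^bsub>F\<^esub>) = 1"
  using assms by (simp add: bicrossed_product_def bvec_def)

text \<open>
  Otherwise \<open>R R'\<close> would have no component with \<open>G\<close>-labels \<open>a, b\<close> at all, whereas the unit contains
  \<open>(p\<^sub>a # 1) \<otimes> (p\<^sub>b # 1)\<close>.
\<close>

lemma right_invertible_meets_all:
  assumes "finite (carrier G)" and RR': "amul H2 R R' = unt H2"
    and "a \<in> carrier G" "b \<in> carrier G"
  obtains f f' where "f \<in> carrier F" "f' \<in> carrier F" "R ((a, f), (b, f')) \<noteq> 0"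
proof -
  have "amul H2 R R' ((a, \<one>\<^bsub>F\<^esub>), (b, \<one>\<^bsub>F\<^esub>)) = 1"
    using assms by (simp add: RR' tensor_alg_def tens_def unt_H)
  then have "amul H2 R R' ((a, \<one>\<^bsub>F\<^esub>), (b, \<one>\<^bsub>F\<^esub>)) \<noteq> 0"
    by simp
  then show thesis
    by (rule amul_H2_nonzeroE) (rule that)
qed

text \<open>
  On \<open>p\<^sub>z # 1\<close> the cocycle \<open>\<tau>\<close> is trivial by normalization and \<open>\<triangleright>\<close> fixes \<open>1\<close>, so the coproduct is dual
  to the multiplication of \<open>G\<close>.
\<close>

lemma comul_delta:
  assumes "finite (carrier F)" "finite (carrier G)"
    and "z \<in> carrier G" "u \<in> carrier G" "v \<in> carrier G"
  shows "comul H (bvec (z, \<one>\<^bsub>F\<^esub>)) ((u, k), (v, l)) =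
    (if u \<otimes>\<^bsub>G\<^esub> v = z \<and> k = \<one>\<^bsub>F\<^esub> \<and> l = \<one>\<^bsub>F\<^esub> then 1 else 0)"
proof -
  have "comul H (bvec (z, \<one>\<^bsub>F\<^esub>)) ((u, k), (v, l)) = comulc H (z, \<one>\<^bsub>F\<^esub>) ((u, k), (v, l))"
  proof -
    have "(\<Sum>b\<in>basis H. bvec (z, \<one>\<^bsub>F\<^esub>) b * comulc H b ((u, k), (v, l))) =
        (\<Sum>b\<in>basis H. if b = (z, \<one>\<^bsub>F\<^esub>) then comulc H b ((u, k), (v, l)) else 0)"
      by (rule sum.cong) (auto simp: bvec_def)
    then show ?thesis
      using assms by (simp add: comul_def lin_def)
  qed
  also have "\<dots> = (\<Sum>x\<in>carrier G.
      if x = v then if u = z \<otimes>\<^bsub>G\<^esub> inv\<^bsub>G\<^esub> v \<and> k = \<one>\<^bsub>F\<^esub> \<and> l = \<one>\<^bsub>F\<^esub> then 1 else 0 else 0)"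
  proof -
    have "\<tau> (z \<otimes>\<^bsub>G\<^esub> inv\<^bsub>G\<^esub> x) x \<one>\<^bsub>F\<^esub> *
        bvec ((z \<otimes>\<^bsub>G\<^esub> inv\<^bsub>G\<^esub> x, lact x \<one>\<^bsub>F\<^esub>), (x, \<one>\<^bsub>F\<^esub>)) ((u, k), (v, l)) =
        (if x = v then if u = z \<otimes>\<^bsub>G\<^esub> inv\<^bsub>G\<^esub> v \<and> k = \<one>\<^bsub>F\<^esub> \<and> l = \<one>\<^bsub>F\<^esub> then 1 else 0 else 0)"
      if "x \<in> carrier G" for x
      using that assms by (cases "x = v") (simp_all add: bvec_def lact_one tau_norm3)
    then show ?thesis
      by (simp add: bicrossed_product_def cong: sum.cong)
  qed
  also have "\<dots> = (if u = z \<otimes>\<^bsub>G\<^esub> inv\<^bsub>G\<^esub> v \<and> k = \<one>\<^bsub>F\<^esub> \<and> l = \<one>\<^bsub>F\<^esub> then 1 else 0)"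
    using assms by simp
  also have "u = z \<otimes>\<^bsub>G\<^esub> inv\<^bsub>G\<^esub> v \<longleftrightarrow> u \<otimes>\<^bsub>G\<^esub> v = z"
    using assms G.inv_solve_right[of u z v] by auto
  finally show ?thesis .
qed

text \<open>
  Multiplication by \<open>\<Delta>\<^sup>o\<^sup>p(p\<^sub>z # 1)\<close> from the left does not change the coefficients at
  \<open>(p\<^sub>a # f) \<otimes> (p\<^sub>b # f')\<close> with \<open>b a = z\<close>, since its summand \<open>(p\<^sub>a # 1) \<otimes> (p\<^sub>b # 1)\<close> projects onto the
  span of these vectors for fixed \<open>a\<close> and \<open>b\<close>.
\<close>

lemma amul_flip_comul_delta:
  assumes fin: "finite (carrier F)" "finite (carrier G)"
    and [simp]: "a \<in> carrier G" "b \<in> carrier G" "f \<in> carrier F" "f' \<in> carrier F"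
  shows "amul H2 (tensor_flip (comul H (bvec (b \<otimes>\<^bsub>G\<^esub> a, \<one>\<^bsub>F\<^esub>)))) R ((a, f), (b, f')) = R ((a, f), (b, f'))"
proof -
  let ?D = "tensor_flip (comul H (bvec (b \<otimes>\<^bsub>G\<^esub> a, \<one>\<^bsub>F\<^esub>)))"
  let ?B = "(basis H \<times> basis H) \<times> (basis H \<times> basis H)"
  let ?t = "\<lambda>(u, v). ?D u * R v * mulc H2 u v ((a, f), (b, f'))"
  let ?w = "(((a, \<one>\<^bsub>F\<^esub>), (b, \<one>\<^bsub>F\<^esub>)), ((a, f), (b, f')))"
  have only: "w = ?w" if "w \<in> ?B" "?t w \<noteq> 0" for w
    using that fin by (auto simp: tensor_flip_def comul_delta mulc_H2 mulc_H ract_one split: if_splits)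
  have "(\<Sum>w\<in>?B. ?t w) = (\<Sum>w\<in>{?w}. ?t w)"
  proof (rule sum.mono_neutral_right)
    show "finite ?B" "{?w} \<subseteq> ?B"
      using fin by simp_all
    show "\<forall>w\<in>?B - {?w}. ?t w = 0"
      using only by blast
  qed
  then show ?thesis
    using fin by (simp add: amul_H2 tensor_flip_def comul_delta mulc_H2 mulc_H ract_one sigma_norm1)
qed

text \<open>
  With \<open>z = b a\<close>, the coefficient of \<open>R\<close> at \<open>(p\<^sub>a # f) \<otimes> (p\<^sub>b # f')\<close> survives on the left of the
  intertwining equation; on the right it survives only if \<open>\<Delta>(p\<^sub>z # 1)\<close> has a summand with labels
  \<open>a \<triangleleft> f\<close> and \<open>b \<triangleleft> f'\<close>, whose product must then be \<open>z\<close>.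
\<close>

lemma intertwiner_support:
  assumes fin: "finite (carrier F)" "finite (carrier G)"
    and intertwines: "\<forall>h\<in>vecs (basis H). amul H2 (tensor_flip (comul H h)) R = amul H2 R (comul H h)"
    and mem: "a \<in> carrier G" "b \<in> carrier G" "f \<in> carrier F" "f' \<in> carrier F"
    and nonzero: "R ((a, f), (b, f')) \<noteq> 0"
  shows "b \<otimes>\<^bsub>G\<^esub> a = ract a f \<otimes>\<^bsub>G\<^esub> ract b f'"
proof -
  let ?p = "bvec (b \<otimes>\<^bsub>G\<^esub> a, \<one>\<^bsub>F\<^esub>) :: 'g \<times> 'f \<Rightarrow> 'k"
  have "?p \<in> vecs (basis H)"
    using mem by (auto simp: vecs_def bvec_def)
  then have "amul H2 R (comul H ?p) ((a, f), (b, f')) = R ((a, f), (b, f'))"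
    using amul_flip_comul_delta[OF fin mem] intertwines by metis
  then have "amul H2 R (comul H ?p) ((a, f), (b, f')) \<noteq> 0"
    using nonzero by simp
  then obtain k k' l l' where
    "k \<in> carrier F" "k' \<in> carrier F"
    and "comul H ?p ((ract a k, l), (ract b k', l')) \<noteq> 0"
    and "f = k \<otimes>\<^bsub>F\<^esub> l" "f' = k' \<otimes>\<^bsub>F\<^esub> l'"
    by (rule amul_H2_nonzeroE)
  then show ?thesis
    using fin mem by (auto simp: comul_delta ract_closed split: if_splits)
qed

lemma orb_mult_subset:
  assumes fin: "finite (carrier F)" "finite (carrier G)"
    and quasi: "quasitriangular_hopf_algebra H"
    and gh: "g \<in> carrier G" "h \<in> carrier G"
  shows "orb F ract h <#>\<^bsub>G\<^esub> orb F ract g \<subseteq> orb F ract g <#>\<^bsub>G\<^esub> orb F ract h"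
proof
  fix x assume "x \<in> orb F ract h <#>\<^bsub>G\<^esub> orb F ract g"
  then obtain a b where ab: "a \<in> orb F ract g" "b \<in> orb F ract h" and x: "x = b \<otimes>\<^bsub>G\<^esub> a"
    by (auto simp: set_mult_def)
  then have mem: "a \<in> carrier G" "b \<in> carrier G"
    using orb_subset gh by auto
  obtain R R' where RR': "amul H2 R R' = unt H2"
    and intertwines: "\<forall>h\<in>vecs (basis H). amul H2 (tensor_flip (comul H h)) R = amul H2 R (comul H h)"
    using quasi unfolding quasitriangular_hopf_algebra_def Let_def by blast
  obtain f f' where ff': "f \<in> carrier F" "f' \<in> carrier F" and "R ((a, f), (b, f')) \<noteq> 0"
    using right_invertible_meets_all[OF fin(2) RR' mem] .
  then have "x = ract a f \<otimes>\<^bsub>G\<^esub> ract b f'"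
    using intertwiner_support[OF fin intertwines mem] x by blast
  moreover have "ract a f \<in> orb F ract g" "ract b f' \<in> orb F ract h"
    using ract_in_orb ab gh ff' by auto
  ultimately show "x \<in> orb F ract g <#>\<^bsub>G\<^esub> orb F ract h"
    by (auto simp: set_mult_def)
qed

end

theorem proposition3p17:
  fixes F :: "('f, 'm) monoid_scheme" and G :: "('g, 'n) monoid_scheme"
    and ract :: "'g \<Rightarrow> 'f \<Rightarrow> 'g" and lact :: "'g \<Rightarrow> 'f \<Rightarrow> 'f"
    and \<sigma> :: "'g \<Rightarrow> 'f \<Rightarrow> 'f \<Rightarrow> 'k::{alg_closed_field, field_char_0}"
    and \<tau> :: "'g \<Rightarrow> 'g \<Rightarrow> 'f \<Rightarrow> 'k"
  assumes "bicrossed_datum F G ract lact \<sigma> \<tau>"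
    and "finite (carrier F)" and "finite (carrier G)"
    and "quasitriangular_hopf_algebra (bicrossed_product F G ract lact \<sigma> \<tau>)"
  shows "\<forall>g\<in>carrier G. \<forall>g'\<in>carrier G.
    orb F ract g <#>\<^bsub>G\<^esub> orb F ract g' = orb F ract g' <#>\<^bsub>G\<^esub> orb F ract g"
proof -
  interpret bicrossed_datum F G ract lact \<sigma> \<tau>
    by (rule assms(1))
  show ?thesis
    using orb_mult_subset[OF assms(2-4)] by blast
qed

end
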